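(* Let $f:\mathbb{R}^n\to\mathbb{R}\cup\{\infty\}$ be a proper, lower semicontinuous, convex function with $\mathrm{dom}\,f$ unbounded. Then $$\partial f(\infty)\subset\mathrm{cl}(\mathrm{dom}\,f^* ).$$ Moreover, if $f:\mathbb{R}^n\to\mathbb{R}$ is (finite-valued and) sublinear, then $T(\infty_I;\mathrm{epi}\,f)=\mathrm{epi}\,f$, the set $\mathrm{dom}\,f^*$ is closed, and $$\partial f(\infty)=\partial f(0)=\mathrm{dom}\,f^*.$$
   Context: $\mathrm{dom}\,f=\{x\mid f(x)<\infty\}$; $f$ is proper if $\mathrm{dom}\,f\ne\emptyset$; $\mathrm{epi}\,f=\{(x,r)\in\mathbb{R}^n\times\mathbb{R}\mid r\ge f(x)\}$; $\mathrm{cl}$ is topological closure. The Fenchel conjugate is $f^*(u)=\sup_{x}\{\langle u,x\rangle-f(x)\}$ and $\mathrm{dom}\,f^*=\{u\mid f^*(u)<\infty\}$. $\partial f(0)$ is the usual convex subdifferential at $0$. Sublinear means subadditive and positively homogeneous. With $I=\{1,\dots,n\}$ selecting the $x$-coordinates in $\mathbb{R}^n\times\mathbb{R}$: $T(\infty_I;\mathrm{epi}\,f)$ is the set of $(w,\rho)$ such that for all sequences $(x_k,r_k)\in\mathrm{epi}\,f$ with $\|x_k\|\to\infty$ and all $t_k>0$ with $t_k\to0$ there exist $(w_k,\rho_k)\to(w,\rho)$ with $(x_k,r_k)+t_k(w_k,\rho_k)\in\mathrm{epi}\,f$ for all $k$. $N(\infty_I;\mathrm{epi}\,f)=\{(u,c)\mid\langle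 u,w\rangle+c\rho\le0\ \forall(w,\rho)\in T(\infty_I;\mathrm{epi}\,f)\}$, and $\partial f(\infty)=\{u\in\mathbb{R}^n\mid(u,-1)\in N(\infty_I;\mathrm{epi}\,f)\}$. *)

theory Defs
  imports "HOL-Analysis.Analysis"
begin

text \<open>Functions into \<open>\<real> \<union> {\<infinity>}\<close> are modelled as \<^typ>\<open>ereal\<close>-valued functions that never take
  the value \<open>-\<infinity>\<close>; the latter is a separate hypothesis and not part of being proper.\<close>

definition edom :: "('a \<Rightarrow> ereal) \<Rightarrow> 'a set" where
  "edom f = {x. f x < \<infinity>}"

definition proper_fun :: "('a \<Rightarrow> ereal) \<Rightarrow> bool" where
  "proper_fun f \<longleftrightarrow> edom f \<noteq> {}"

definition epi :: "('a \<Rightarrow> ereal) \<Rightarrow> ('a \<times> real) set" where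
  "epi f = {(x, r). f x \<le> ereal r}"

definition lower_semicontinuous :: "('a::topological_space \<Rightarrow> ereal) \<Rightarrow> bool" where
  "lower_semicontinuous f \<longleftrightarrow> (\<forall>x. f x \<le> Liminf (at x) f)"

text \<open>The counterpart of \<^const>\<open>convex_on\<close>, which is only available for real-valued functions.
  In \<^typ>\<open>ereal\<close>, \<open>0 * \<infinity> = 0\<close>, so the cases \<open>u = 0\<close> and \<open>v = 0\<close> are trivial.\<close>

definition convex_fun :: "('a::real_vector \<Rightarrow> ereal) \<Rightarrow> bool" where
  "convex_fun f \<longleftrightarrow>
    (\<forall>x y. \<forall>u\<ge>0. \<forall>v\<ge>0. u + v = 1 \<longrightarrow>
      f (u *\<^sub>R x + v *\<^sub>R y) \<le> ereal u * f x + ereal v * f y)"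

definition sublinear_fun :: "('a::real_vector \<Rightarrow> ereal) \<Rightarrow> bool" where
  "sublinear_fun f \<longleftrightarrow>
    (\<forall>x y. f (x + y) \<le> f x + f y) \<and>
    (\<forall>t>0. \<forall>x. f (t *\<^sub>R x) = ereal t * f x)"

definition fenchel_conjugate :: "('a::real_inner \<Rightarrow> ereal) \<Rightarrow> 'a \<Rightarrow> ereal" where
  "fenchel_conjugate f u = (SUP x. ereal (u \<bullet> x) - f x)"

definition subdifferential :: "('a::real_inner \<Rightarrow> ereal) \<Rightarrow> 'a \<Rightarrow> 'a set" where
  "subdifferential f a =
    {u. \<bar>f a\<bar> \<noteq> \<infinity> \<and> (\<forall>x. f a + ereal (u \<bullet> (x - a)) \<le> f x)}"

text \<open>The cones \<open>T(\<infinity>\<^sub>I; C)\<close> and \<open>N(\<infinity>\<^sub>I; C)\<close> for \<open>C \<subseteq> \<real>\<^sup>n \<times> \<real>\<close>, where the index set \<open>I\<close>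
  selects the \<open>\<real>\<^sup>n\<close>-component: only that component of the base points is required to be unbounded.\<close>

definition tangent_cone_infinity ::
    "('a::real_normed_vector \<times> real) set \<Rightarrow> ('a \<times> real) set" where
  "tangent_cone_infinity C =
    {p. \<forall>(z :: nat \<Rightarrow> 'a \<times> real) (t :: nat \<Rightarrow> real).
      (\<forall>k. z k \<in> C) \<and> filterlim (\<lambda>k. norm (fst (z k))) at_top sequentially \<and>
      (\<forall>k. t k > 0) \<and> t \<longlonglongrightarrow> 0 \<longrightarrow>
      (\<exists>q. q \<longlonglongrightarrow> p \<and> (\<forall>k. z k + t k *\<^sub>R q k \<in> C))}"

definition normal_cone_infinity ::
    "('a::real_inner \<times> real) set \<Rightarrow> ('a \<times> real) set" where
  "normal_cone_infinity C =
    {(u, c). \<forall>(w, \<rho>) \<in> tangent_cone_infinity C. u \<bullet> w + c * \<rho> \<le> 0}"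

definition subdifferential_infinity :: "('a::real_inner \<Rightarrow> ereal) \<Rightarrow> 'a set" where
  "subdifferential_infinity f = {u. (u, -1) \<in> normal_cone_infinity (epi f)}"

end

theory Submission
  imports Defs
begin

text \<open>If \<open>u\<close> lies outside the closed convex set \<open>cl (dom f\<^sup>*)\<close>, a hyperplane gives \<open>w\<close> and \<open>b\<close> with
  \<open>\<langle>v, w\<rangle> \<le> b < \<langle>u, w\<rangle>\<close> for all \<open>v \<in> dom f\<^sup>*\<close>. As \<open>f\<close> is the supremum of its affine minorants,
  whose slopes lie in \<open>dom f\<^sup>*\<close>, we get \<open>f (x + t w) \<le> f x + t b\<close>; hence \<open>(w, b)\<close> is a tangent
  direction at infinity, which excludes \<open>u\<close> from \<open>\<partial>f(\<infinity>)\<close>.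

  For finite sublinear \<open>f\<close>, the epigraph is closed under addition, so it consists of tangent
  directions. Conversely, testing a tangent direction \<open>(w, \<rho>)\<close> along \<open>(k e, f (k e))\<close> with \<open>e = w\<close>
  (any \<open>e \<noteq> 0\<close> if \<open>w = 0\<close>) yields \<open>f w \<le> \<rho>\<close>.\<close>

section \<open>Slopes of affine minorants\<close>

text \<open>A real bound \<open>a\<close> on the supremum says exactly that the affine function with
  slope \<open>u\<close> and constant \<open>-a\<close> lies below \<open>f\<close>. The conjugate
  is used below only in this form.\<close>

lemma edom_fenchel_conjugate:
  "edom (fenchel_conjugate f) = {u. \<exists>a. \<forall>x. ereal (u \<bullet> x - a) \<le> f x}"
proof -
  have le: "ereal (u \<bullet> x) - f x \<le> ereal a \<longleftrightarrow> ereal (u \<bullet> x - a) \<le> f x" for u x a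
    by (cases "f x") auto
  have "fenchel_conjugate f u < \<infinity> \<longleftrightarrow> (\<exists>a. fenchel_conjugate f u \<le> ereal a)" for u
    by (cases "fenchel_conjugate f u") auto
  then show ?thesis
    unfolding edom_def by (auto simp: fenchel_conjugate_def SUP_le_iff le)
qed

lemma convex_edom_fenchel_conjugate: "convex (edom (fenchel_conjugate f))"
proof (rule convexI)
  fix u v :: 'a and s t :: real
  assume uv: "u \<in> edom (fenchel_conjugate f)" "v \<in> edom (fenchel_conjugate f)"
    and st: "0 \<le> s" "0 \<le> t" "s + t = 1"
  from uv obtain a b where a: "\<And>x. ereal (u \<bullet> x - a) \<le> f x" and b: "\<And>x. ereal (v \<bullet> x - b) \<le> f x"
    unfolding edom_fenchel_conjugate by blast
  have "ereal ((s *\<^sub>R u + t *\<^sub>R v) \<bullet> x - (s * a + t * b)) \<le> f x" for x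
  proof (cases "f x")
    case (real r)
    then have "s * (u \<bullet> x - a) + t * (v \<bullet> x - b) \<le> r"
      using a[of x] b[of x] st by (intro convex_bound_le) auto
    then show ?thesis
      using real by (simp add: inner_left_distrib algebra_simps)
  qed (use a[of x] in auto)
  then show "s *\<^sub>R u + t *\<^sub>R v \<in> edom (fenchel_conjugate f)"
    unfolding edom_fenchel_conjugate by blast
qed

section \<open>Separation from the epigraph and affine minorants\<close>

lemma convex_epi:
  assumes "convex_fun f"
  shows "convex (epi f)"
proof (rule convexI)
  fix p q :: "'a \<times> real" and s t :: real
  assume pq: "p \<in> epi f" "q \<in> epi f" and st: "0 \<le> s" "0 \<le> t" "s + t = 1"
  obtain x a y b where [simp]: "p = (x, a)" "q = (y, b)" by fastforce
  have "f (s *\<^sub>R x + t *\<^sub>R y) \<le> ereal s * f x + ereal t * f y"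
    using assms st unfolding convex_fun_def by blast
  also have "\<dots> \<le> ereal s * ereal a + ereal t * ereal b"
    using pq st by (intro add_mono ereal_mult_left_mono) (auto simp: epi_def)
  finally show "s *\<^sub>R p + t *\<^sub>R q \<in> epi f"
    by (simp add: epi_def)
qed

lemma closed_epi:
  assumes "lower_semicontinuous f"
  shows "closed (epi f)"
proof -
  have "\<exists>T. open T \<and> p \<in> T \<and> T \<subseteq> - epi f" if p: "p \<in> - epi f" for p
  proof -
    obtain x r where [simp]: "p = (x, r)" by fastforce
    from p have "ereal r < f x" by (auto simp: epi_def)
    \<comment> \<open>The gap between \<open>r\<close> and \<open>c\<close> leaves room in the
      second coordinate for an open box that misses the epigraph.\<close>
    then obtain c where c: "ereal r < ereal c" "ereal c < f x"
      using ereal_dense2 by blast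
    then have "ereal c < Liminf (at x) f"
      using assms unfolding lower_semicontinuous_def by (meson less_le_trans)
    then have "eventually (\<lambda>y. ereal c < f y) (at x)"
      using less_LiminfD by blast
    \<comment> \<open>The filter \<open>at x\<close> leaves out \<open>x\<close> itself; there the
      bound is \<open>ereal c < f x\<close>.\<close>
    then obtain S where S: "open S" "x \<in> S" "\<And>y. y \<in> S \<Longrightarrow> ereal c < f y"
      using c unfolding eventually_at_topological by (metis UNIV_I)
    have "open (S \<times> {..<c})" "p \<in> S \<times> {..<c}"
      using S c by (auto intro: open_Times)
    moreover have "S \<times> {..<c} \<subseteq> - epi f"
    proof
      fix q assume "q \<in> S \<times> {..<c}"
      then obtain y s where [simp]: "q = (y, s)" and "y \<in> S" "s < c" by auto
      then have "ereal s < f y"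
        using S(3)[of y] by (meson less_trans ereal_less(1) less_ereal.simps(1))
      then show "q \<in> - epi f" by (auto simp: epi_def)
    qed
    ultimately show ?thesis by blast
  qed
  then have "open (- epi f)" by (subst open_subopen) blast
  then show ?thesis by (simp add: closed_def)
qed

text \<open>The epigraph is closed and convex, so a hyperplane separates the point strictly; since
  it is unbounded upwards, the vertical coefficient cannot be negative.\<close>

lemma separate_point_epi:
  fixes f :: "'a::euclidean_space \<Rightarrow> ereal"
  assumes "proper_fun f" "lower_semicontinuous f" "convex_fun f" "ereal r < f x0"
  obtains p c b where "0 \<le> c" "p \<bullet> x0 + c * r < b"
    "\<And>x s. f x \<le> ereal s \<Longrightarrow> b < p \<bullet> x + c * s"
proof -
  have "(x0, r) \<notin> epi f" using assms(4) by (auto simp: epi_def)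
  then obtain q b where q: "q \<bullet> (x0, r) < b" "\<forall>z\<in>epi f. q \<bullet> z > b"
    using separating_hyperplane_closed_point[OF convex_epi closed_epi] assms by metis
  obtain p c where [simp]: "q = (p, c)" by fastforce
  have sep: "b < p \<bullet> x + c * s" if "f x \<le> ereal s" for x s
    using q(2) that by (force simp: epi_def)
  obtain y where "f y < \<infinity>" using assms(1) by (auto simp: proper_fun_def edom_def)
  then obtain s where s: "f y \<le> ereal s" by (cases "f y") auto
  have "0 \<le> c"
  proof (rule ccontr)
    assume "\<not> 0 \<le> c"
    \<comment> \<open>For \<open>c < 0\<close> the functional equals \<open>b\<close> at height
      \<open>(b - p \<bullet> y) / c\<close> over \<open>y\<close> and falls further above it; the
      maximum with \<open>s\<close> stays in the epigraph.\<close>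
    define m where "m = max s ((b - p \<bullet> y) / c)"
    have "f y \<le> ereal m" using s by (rule order_trans) (simp add: m_def)
    then have "b < p \<bullet> y + c * m" by (rule sep)
    moreover have "c * m \<le> c * ((b - p \<bullet> y) / c)"
      using \<open>\<not> 0 \<le> c\<close> by (intro mult_left_mono_neg) (auto simp: m_def)
    ultimately show False using \<open>\<not> 0 \<le> c\<close> by simp
  qed
  then show ?thesis using that[of c p b] q(1) sep by simp
qed

text \<open>A nonvertical hyperplane is the graph of an affine function: solving
  \<open>p \<bullet> x + c * s = b\<close> for \<open>s\<close> gives the slope
  \<open>-p / c\<close> and the constant term \<open>b / c\<close>.\<close>

lemma affine_minorant_of_separation:
  fixes f :: "'a::real_inner \<Rightarrow> ereal"
  assumes ninf: "\<And>x. f x \<noteq> -\<infinity>" and "0 < c" "p \<bullet> x0 + c * r < b"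
    and sep: "\<And>x s. f x \<le> ereal s \<Longrightarrow> b < p \<bullet> x + c * s"
  obtains v a where "\<And>x. ereal (v \<bullet> x - a) \<le> f x" "r < v \<bullet> x0 - a"
proof
  show "ereal ((- (1 / c) *\<^sub>R p) \<bullet> x - (- b / c)) \<le> f x" for x
  proof (cases "f x")
    case (real s)
    then show ?thesis using sep[of x s] \<open>0 < c\<close> by (simp add: field_simps)
  qed (use ninf[of x] in auto)
  show "r < (- (1 / c) *\<^sub>R p) \<bullet> x0 - (- b / c)"
    using assms by (simp add: field_simps)
qed

text \<open>The hyperplane separating \<open>(x0, r)\<close> from the epigraph is itself a minorant
  unless it is vertical, which can happen only if \<open>f x0 = \<infinity>\<close>.\<close>

lemma affine_minorant_above:
  fixes f :: "'a::euclidean_space \<Rightarrow> ereal"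
  assumes ninf: "\<And>x. f x \<noteq> -\<infinity>"
    and f: "proper_fun f" "lower_semicontinuous f" "convex_fun f" and r: "ereal r < f x0"
  obtains v a where "\<And>x. ereal (v \<bullet> x - a) \<le> f x" "r < v \<bullet> x0 - a"
proof -
  obtain p c b where c: "0 \<le> c" and p: "p \<bullet> x0 + c * r < b"
    and sep: "\<And>x s. f x \<le> ereal s \<Longrightarrow> b < p \<bullet> x + c * s"
    using separate_point_epi[OF f r] by metis
  show ?thesis
  proof (cases "c = 0")
    case False
    with c have "0 < c" by simp
    from affine_minorant_of_separation[where f = f, OF ninf this p sep] that show ?thesis by blast
  next
    case True
    text \<open>The separating hyperplane is vertical: tilt a nonvertical minorant by a large multiple of it.\<close>
    obtain y where "f y < \<infinity>" using f(1) by (auto simp: proper_fun_def edom_def)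
    then obtain s where s: "f y = ereal s" using ninf[of y] by (cases "f y") auto
    \<comment> \<open>Separating a point just below a finite value excludes \<open>c' = 0\<close>:
      otherwise \<open>p' \<bullet> y\<close> would be both below and above
      \<open>b'\<close>.\<close>
    then have s': "ereal (s - 1) < f y" by simp
    obtain p' c' b' where c': "0 \<le> c'" and p': "p' \<bullet> y + c' * (s - 1) < b'"
      and sep': "\<And>x s. f x \<le> ereal s \<Longrightarrow> b' < p' \<bullet> x + c' * s"
      using separate_point_epi[OF f s'] by metis
    have "c' \<noteq> 0" using p' sep'[of y s] s by auto
    with c' have "0 < c'" by simp
    from affine_minorant_of_separation[where f = f, OF ninf this p' sep']
    obtain v a where va: "\<And>x. ereal (v \<bullet> x - a) \<le> f x" by metis
    have gap: "0 < b - p \<bullet> x0" using p True by simp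
    obtain l where l: "0 \<le> l" "r < v \<bullet> x0 - a + l * (b - p \<bullet> x0)"
    proof
      let ?l = "(\<bar>r - (v \<bullet> x0 - a)\<bar> + 1) / (b - p \<bullet> x0)"
      show "0 \<le> ?l" using gap by simp
      show "r < v \<bullet> x0 - a + ?l * (b - p \<bullet> x0)" using gap by simp
    qed
    \<comment> \<open>The added term \<open>l * (b - p \<bullet> x)\<close> is nonpositive wherever
      \<open>f\<close> is finite, but positive at \<open>x0\<close>, where \<open>l\<close> makes it
      large enough to pass \<open>r\<close>.\<close>
    have minor: "ereal ((v - l *\<^sub>R p) \<bullet> x - (a - l * b)) \<le> f x" for x
    proof (cases "f x")
      case (real s)
      then have "l * (b - p \<bullet> x) \<le> 0"
        using sep[of x s] l True by (intro mult_nonneg_nonpos) auto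
      then show ?thesis using va[of x] real by (simp add: inner_diff_left algebra_simps)
    qed (use ninf[of x] in auto)
    show ?thesis
      by (rule that[OF minor]) (use l in \<open>simp add: inner_diff_left algebra_simps\<close>)
  qed
qed

section \<open>The inclusion into the closure\<close>

text \<open>Recession directions are tangent at infinity: the constant sequence serves for all base
  points and step sizes.\<close>

lemma tangent_cone_infinityI:
  assumes "\<And>z t. z \<in> C \<Longrightarrow> 0 < t \<Longrightarrow> z + t *\<^sub>R p \<in> C"
  shows "p \<in> tangent_cone_infinity C"
  unfolding tangent_cone_infinity_def
  by (intro CollectI allI impI exI[of _ "\<lambda>_. p"]) (simp add: assms)

lemma subdifferential_infinity_subset_closure:
  fixes f :: "'a::euclidean_space \<Rightarrow> ereal"
  assumes ninf: "\<And>x. f x \<noteq> -\<infinity>"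
    and f: "proper_fun f" "lower_semicontinuous f" "convex_fun f"
  shows "subdifferential_infinity f \<subseteq> closure (edom (fenchel_conjugate f))"
proof (rule subsetI, rule ccontr)
  fix u assume u: "u \<in> subdifferential_infinity f"
    and "u \<notin> closure (edom (fenchel_conjugate f))"
  then obtain w b where wb: "w \<bullet> u < b" "\<forall>v\<in>closure (edom (fenchel_conjugate f)). w \<bullet> v > b"
    using separating_hyperplane_closed_point[of "closure (edom (fenchel_conjugate f))" u]
    by (auto simp: convex_closure convex_edom_fenchel_conjugate)
  \<comment> \<open>The separation reads \<open>w \<bullet> u < b < w \<bullet> v\<close>, hence the
    reversed signs.\<close>
  have "(- w, - b) \<in> tangent_cone_infinity (epi f)"
  proof (rule tangent_cone_infinityI)
    fix z :: "'a \<times> real" and t :: real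
    assume z: "z \<in> epi f" and t: "0 < t"
    obtain x s where [simp]: "z = (x, s)" by fastforce
    \<comment> \<open>Otherwise some minorant exceeds \<open>s - t * b\<close> at
      \<open>x - t *\<^sub>R w\<close>; moving back to \<open>x\<close> raises it by
      \<open>t * (w \<bullet> v) > t * b\<close>, so it exceeds \<open>s\<close> at
      \<open>x\<close>.\<close>
    have "f (x - t *\<^sub>R w) \<le> ereal (s - t * b)"
    proof (rule ccontr)
      assume "\<not> ?thesis"
      then have "ereal (s - t * b) < f (x - t *\<^sub>R w)" by simp
      then obtain v a where va: "\<And>y. ereal (v \<bullet> y - a) \<le> f y"
          "s - t * b < v \<bullet> (x - t *\<^sub>R w) - a"
        using affine_minorant_above[OF ninf f] by metis
      then have "v \<in> edom (fenchel_conjugate f)"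
        unfolding edom_fenchel_conjugate by blast
      then have "b < w \<bullet> v" using wb(2) closure_subset by blast
      then have "t * b < t * (w \<bullet> v)" using t by simp
      moreover have "ereal (v \<bullet> x - a) \<le> ereal s"
        by (rule order_trans[OF va(1)]) (use z in \<open>simp add: epi_def\<close>)
      ultimately show False using va(2) by (simp add: inner_diff_right inner_commute)
    qed
    then show "z + t *\<^sub>R (- w, - b) \<in> epi f" by (simp add: epi_def)
  qed
  then have "u \<bullet> (- w) + (- 1) * (- b) \<le> 0"
    using u unfolding subdifferential_infinity_def normal_cone_infinity_def by blast
  then show False using wb(1) by (simp add: inner_commute)
qed

section \<open>Finite sublinear functions\<close>

text \<open>Sublinearity implies convexity, and a finite convex function on a Euclidean space is
  continuous. This disposes of the error term \<open>g (w - fst (q k))\<close> in the tangent cone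
  computation.\<close>

lemma sublinear_real_tendsto_0:
  fixes g :: "'a::euclidean_space \<Rightarrow> real"
  assumes sub: "\<And>x y. g (x + y) \<le> g x + g y" and hom: "\<And>t x. 0 < t \<Longrightarrow> g (t *\<^sub>R x) = t * g x"
    and "y \<longlonglongrightarrow> 0"
  shows "(\<lambda>k. g (y k)) \<longlonglongrightarrow> 0"
proof -
  have g0: "g 0 = 0" using hom[of 2 0] by simp
  have "convex_on UNIV g"
  proof (rule convex_onI)
    fix t :: real and x y :: 'a
    assume "0 < t" "t < 1"
    then show "g ((1 - t) *\<^sub>R x + t *\<^sub>R y) \<le> (1 - t) * g x + t * g y"
      using sub[of "(1 - t) *\<^sub>R x" "t *\<^sub>R y"] by (simp add: hom)
  qed simp
  then have "continuous_on UNIV g" by (intro convex_on_continuous) auto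
  then have "isCont g 0" by (simp add: continuous_on_eq_continuous_at)
  from isCont_tendsto_compose[OF this assms(3)] g0 show ?thesis by simp
qed

lemma tangent_cone_infinity_epi_sublinear:
  fixes g :: "'a::euclidean_space \<Rightarrow> real"
  assumes sub: "\<And>x y. g (x + y) \<le> g x + g y" and hom: "\<And>t x. 0 < t \<Longrightarrow> g (t *\<^sub>R x) = t * g x"
  shows "tangent_cone_infinity (epi (\<lambda>x. ereal (g x))) = epi (\<lambda>x. ereal (g x))" (is "?T = ?E")
proof
  show "?E \<subseteq> ?T"
  proof
    fix p assume "p \<in> ?E"
    then obtain w \<rho> where [simp]: "p = (w, \<rho>)" and w: "g w \<le> \<rho>" by (auto simp: epi_def)
    show "p \<in> ?T"
    proof (rule tangent_cone_infinityI)
      fix z :: "'a \<times> real" and t :: real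
      assume "z \<in> ?E" "0 < t"
      then obtain x r where [simp]: "z = (x, r)" and r: "g x \<le> r" by (auto simp: epi_def)
      have "t * g w \<le> t * \<rho>" using w \<open>0 < t\<close> by simp
      then have "g (x + t *\<^sub>R w) \<le> r + t * \<rho>"
        using sub[of x "t *\<^sub>R w"] hom[OF \<open>0 < t\<close>, of w] r by simp
      then show "z + t *\<^sub>R p \<in> ?E" by (simp add: epi_def)
    qed
  qed
  have g0: "g 0 = 0" using hom[of 2 0] by simp
  show "?T \<subseteq> ?E"
  proof
    fix p assume p: "p \<in> ?T"
    obtain w \<rho> where [simp]: "p = (w, \<rho>)" by fastforce
    obtain e where e: "e \<noteq> 0" "w = 0 \<or> e = w"
      by (metis nonzero_Basis nonempty_Basis ex_in_conv)
    \<comment> \<open>Subadditivity is an equality here because \<open>e\<close> and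
      \<open>w\<close> lie on a common ray.\<close>
    have split: "g (k *\<^sub>R e + t *\<^sub>R w) = k * g e + t * g w" if "0 < k" "0 < t" for k t
      using e(2) hom[OF that(1), of e] hom[of "k + t" e] that g0
      by (auto simp: algebra_simps)
    \<comment> \<open>The base points lie on the graph itself, so that \<open>g e\<close> cancels
      exactly later; \<open>Suc k\<close> keeps the factors positive, as homogeneity
      requires.\<close>
    define z where "z k = (real (Suc k) *\<^sub>R e, real (Suc k) * g e)" for k
    define t where "t k = inverse (real (Suc k))" for k
    have "filterlim (\<lambda>k. norm e * real (Suc k)) at_top sequentially"
      using e(1) by (intro filterlim_tendsto_pos_mult_at_top[OF tendsto_const]
          filterlim_compose[OF filterlim_real_sequentially filterlim_Suc]) auto
    then have "filterlim (\<lambda>k. norm (fst (z k))) at_top sequentially"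
      by (simp add: z_def mult.commute del: of_nat_Suc)
    moreover have "z k \<in> ?E" for k
      using hom[of "real (Suc k)" e] by (simp add: z_def epi_def del: of_nat_Suc)
    moreover have tpos: "0 < t k" for k by (simp add: t_def)
    moreover have "t \<longlonglongrightarrow> 0" unfolding t_def by (rule LIMSEQ_inverse_real_of_nat)
    ultimately obtain q where q: "q \<longlonglongrightarrow> p" "\<And>k. z k + t k *\<^sub>R q k \<in> ?E"
      using p unfolding tangent_cone_infinity_def by blast
    \<comment> \<open>Replacing \<open>fst (q k)\<close> by \<open>w\<close> costs at most
      \<open>t k * g (w - fst (q k))\<close>. By \<open>split\<close>, the term
      \<open>real (Suc k) * g e\<close> cancels, and division by \<open>t k\<close> remains.\<close>
    have "g w \<le> snd (q k) + g (w - fst (q k))" for k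
    proof -
      have "g (real (Suc k) *\<^sub>R e + t k *\<^sub>R fst (q k)) \<le> real (Suc k) * g e + t k * snd (q k)"
        using q(2)[of k] by (cases "q k") (simp add: z_def epi_def del: of_nat_Suc)
      moreover have "g (real (Suc k) *\<^sub>R e + t k *\<^sub>R w)
          \<le> g (real (Suc k) *\<^sub>R e + t k *\<^sub>R fst (q k)) + t k * g (w - fst (q k))"
        using sub[of "real (Suc k) *\<^sub>R e + t k *\<^sub>R fst (q k)" "t k *\<^sub>R (w - fst (q k))"]
          hom[OF tpos, of k "w - fst (q k)"]
        by (simp add: algebra_simps del: of_nat_Suc)
      ultimately have "t k * g w \<le> t k * (snd (q k) + g (w - fst (q k)))"
        using split[of "real (Suc k)" "t k"] tpos[of k]
        by (simp add: distrib_left del: of_nat_Suc)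
      then show ?thesis using tpos[of k] by simp
    qed
    moreover have "(\<lambda>k. snd (q k) + g (w - fst (q k))) \<longlonglongrightarrow> \<rho>"
    proof -
      have "(\<lambda>k. w - fst (q k)) \<longlonglongrightarrow> 0"
        using tendsto_diff[OF tendsto_const[of w] tendsto_fst[OF q(1)]] by simp
      then have "(\<lambda>k. g (w - fst (q k))) \<longlonglongrightarrow> 0"
        by (rule sublinear_real_tendsto_0[where g = g, rotated 2]) (use sub hom in auto)
      from tendsto_add[OF tendsto_snd[OF q(1)] this] show ?thesis by simp
    qed
    ultimately have "g w \<le> \<rho>"
      by (intro LIMSEQ_le_const[where X = "\<lambda>k. snd (q k) + g (w - fst (q k))"]) auto
    then show "p \<in> ?E" by (simp add: epi_def)
  qed
qed

text \<open>Scaling \<open>x\<close> in \<open>u \<bullet> x - a \<le> g x\<close> bounds every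
  positive multiple of \<open>u \<bullet> x - g x\<close> by the same \<open>a\<close>, so this
  difference cannot be positive; the constant may thus be taken to be 0.\<close>

lemma edom_fenchel_conjugate_sublinear:
  fixes g :: "'a::real_inner \<Rightarrow> real"
  assumes hom: "\<And>t x. 0 < t \<Longrightarrow> g (t *\<^sub>R x) = t * g x"
  shows "edom (fenchel_conjugate (\<lambda>x. ereal (g x))) = {u. \<forall>x. u \<bullet> x \<le> g x}" (is "?D = ?S")
proof
  show "?D \<subseteq> ?S"
  proof
    fix u assume "u \<in> ?D"
    then obtain a where a: "\<And>x. u \<bullet> x - a \<le> g x" by (auto simp: edom_fenchel_conjugate)
    have "u \<bullet> x \<le> g x" for x
    proof (rule ccontr)
      assume "\<not> ?thesis"
      then have d: "0 < u \<bullet> x - g x" by simp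
      \<comment> \<open>Chosen so that \<open>t * (u \<bullet> x - g x) = \<bar>a\<bar> + 1\<close>,
        which exceeds \<open>a\<close>.\<close>
      define t where "t = (\<bar>a\<bar> + 1) / (u \<bullet> x - g x)"
      have "0 < t" using d by (simp add: t_def)
      then have "t * (u \<bullet> x - g x) \<le> a"
        using a[of "t *\<^sub>R x"] by (simp add: hom algebra_simps)
      then show False using d by (simp add: t_def)
    qed
    then show "u \<in> ?S" by blast
  qed
  show "?S \<subseteq> ?D"
    by (auto simp: edom_fenchel_conjugate intro!: exI[of _ 0])
qed

lemma closed_Collect_inner_le: "closed {u::'a::real_inner. \<forall>x. u \<bullet> x \<le> g x}"
  by (intro closed_Collect_all closed_Collect_le continuous_intros)

theorem theorem4p9:
  fixes f :: "real ^ 'n \<Rightarrow> ereal"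
  assumes "\<forall>x. f x \<noteq> -\<infinity>"
  shows
    "(proper_fun f \<and> lower_semicontinuous f \<and> convex_fun f \<and> \<not> bounded (edom f) \<longrightarrow>
        subdifferential_infinity f \<subseteq> closure (edom (fenchel_conjugate f))) \<and>
     ((\<forall>x. \<bar>f x\<bar> \<noteq> \<infinity>) \<and> sublinear_fun f \<longrightarrow>
        tangent_cone_infinity (epi f) = epi f \<and>
        closed (edom (fenchel_conjugate f)) \<and>
        subdifferential_infinity f = subdifferential f 0 \<and>
        subdifferential f 0 = edom (fenchel_conjugate f))"
proof (rule conjI; rule impI)
  assume "proper_fun f \<and> lower_semicontinuous f \<and> convex_fun f \<and> \<not> bounded (edom f)"
  then show "subdifferential_infinity f \<subseteq> closure (edom (fenchel_conjugate f))"
    using assms by (intro subdifferential_infinity_subset_closure) auto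
next
  assume fin: "(\<forall>x. \<bar>f x\<bar> \<noteq> \<infinity>) \<and> sublinear_fun f"
  define g where "g x = real_of_ereal (f x)" for x
  have f: "f = (\<lambda>x. ereal (g x))" using fin by (auto simp: g_def ereal_real)
  have sub: "g (x + y) \<le> g x + g y" and hom: "0 < t \<Longrightarrow> g (t *\<^sub>R x) = t * g x" for x y t
    using fin unfolding sublinear_fun_def f by auto
  have g0: "g 0 = 0" using hom[of 2 0] by simp
  have T: "tangent_cone_infinity (epi f) = epi f"
    unfolding f by (rule tangent_cone_infinity_epi_sublinear[OF sub hom])
  have D: "edom (fenchel_conjugate f) = {u. \<forall>x. u \<bullet> x \<le> g x}"
    unfolding f by (rule edom_fenchel_conjugate_sublinear[OF hom])
  have "subdifferential f 0 = {u. \<forall>x. u \<bullet> x \<le> g x}"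
    unfolding subdifferential_def f by (simp add: g0)
  \<comment> \<open>With the cone equal to the epigraph, the condition is
    \<open>u \<bullet> w \<le> \<rho>\<close> for all \<open>\<rho> \<ge> g w\<close>, and
    \<open>\<rho> = g w\<close> is the strictest case.\<close>
  moreover have "subdifferential_infinity f = {u. \<forall>x. u \<bullet> x \<le> g x}"
    unfolding subdifferential_infinity_def normal_cone_infinity_def T
    by (auto simp: epi_def f intro: order_trans)
  ultimately show "tangent_cone_infinity (epi f) = epi f \<and>
        closed (edom (fenchel_conjugate f)) \<and>
        subdifferential_infinity f = subdifferential f 0 \<and>
        subdifferential f 0 = edom (fenchel_conjugate f)"
    using T D closed_Collect_inner_le[of g] by simp
qed

end
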